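(* Let $L$ be a complete lattice that is strongly coatomic and spatial. Then the following are equivalent. (1) $L$ is (isomorphic to) the closure lattice $\operatorname{Cld}(X,\gamma)$ of some closure system $(X,\gamma)$ with the anti-exchange property. (2) $L$ is (isomorphic to) the closure lattice $\operatorname{Cld}(X,\gamma)$ of some closure system $(X,\gamma)$ with the property that if $A\prec B$ in $\operatorname{Cld}(X,\gamma)$, then $|B\setminus A|=1$. (3) $L$ is join semidistributive and lower semimodular. (4) Every element $w\in L$ is the join of $\operatorname{Ex}(w)$. (5) Every element $w\in L$ has a unique irredundant join decomposition into join irreducible elements, and this decomposition is canonical, i.e., it refines every other join representation of $w$. (6) For every pair of elements $w,c\in L$ with $c\prec w$, there exists a unique $j\in\operatorname{Ji}(L)$ such that $j\leq w$ and $j\nleq c$.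
   Context: Notation: $a\prec b$ means $b$ covers $a$. A lattice $L$ is strongly coatomic if whenever $a<c$ in $L$ there exists $b\in L$ with $a\leq b\prec c$. An element $w$ of a complete lattice is completely join irreducible if $w=\bigvee Y$ implies $w\in Y$ (so $w\neq 0$). A complete lattice is spatial if every element is a join of (possibly an empty set of) completely join irreducible elements. $\operatorname{Ji}(L)$ denotes the set of nonzero join irreducible elements of $L$ ($w$ is join irreducible if $w=x\vee y$ implies $w=x$ or $w=y$), and $\operatorname{Ji}(a)=\{p\in\operatorname{Ji}(L):p\leq a\}$. "Join irreducible elements" in (5) are the members of $\operatorname{Ji}(L)$. A closure system $(X,\gamma)$ is a set $X$ with a closure operator $\gamma$ on its subsets; $\gamma(\emptyset)$ need not be empty. $\operatorname{Cld}(X,\gamma)$ is the lattice of $\gamma$-closed subsets of $X$ ordered by inclusion. $(X,\gamma)$ has the anti-exchange property if for all $x\neq y$ in $X$ and all closed $A\subseteq X$: $x\in\gamma(A\cup\{y\})$ and $x\notin A$ imply $y\notin\gamma(A\cup\{x\})$. $L$ is join semidistributive if $x\vee y=x\vee z$ implies $x\vee y=x\vee(y\wedge z)$. $L$ is lower semimodular if $a\prec b$ implies $a\wedge c\prec b\wedge c$ or $a\wedge c=b\wedge c$, for all $a,b,c\in L$. For $w\in L$, $\operatorname{Ex}(w)$ is the set of extreme points of $w$: those $x\in\operatorname{Ji}(w)$ with $\bigvee(\operatorname{Ji}(w)\setminus\{x\})<w$. A join decomposition (representation) of $w$ is a (possibly infinite, possibly empty) set $A\subseteq L$ with $w=\bigvee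 A$; it is irredundant if $\bigvee(A\setminus\{a\})<w$ for every $a\in A$. A set $A$ refines a set $B$ if for every $a\in A$ there is $b\in B$ with $a\leq b$. *)

theory Defs
  imports Main
begin

unbundle lattice_syntax

text \<open>
  Coverings are relative to a set \<open>S\<close>, so that the same notion serves for a lattice given as a
  type (\<open>S = UNIV\<close>) and for the closed sets of a closure system, ordered by inclusion.
\<close>

definition covered_in :: "'a::order set \<Rightarrow> 'a \<Rightarrow> 'a \<Rightarrow> bool" where
  "covered_in S a b \<longleftrightarrow> a \<in> S \<and> b \<in> S \<and> a < b \<and> \<not> (\<exists>c\<in>S. a < c \<and> c < b)"

abbreviation covered_by :: "'a::order \<Rightarrow> 'a \<Rightarrow> bool" (infix "\<prec>" 50) where
  "a \<prec> b \<equiv> covered_in UNIV a b"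


definition strongly_coatomic :: "'a::lattice itself \<Rightarrow> bool" where
  "strongly_coatomic _ \<longleftrightarrow> (\<forall>a c :: 'a. a < c \<longrightarrow> (\<exists>b. a \<le> b \<and> b \<prec> c))"

definition completely_join_irreducible :: "'a::complete_lattice \<Rightarrow> bool" where
  "completely_join_irreducible w \<longleftrightarrow> (\<forall>Y. w = \<Squnion>Y \<longrightarrow> w \<in> Y)"

definition spatial :: "'a::complete_lattice itself \<Rightarrow> bool" where
  "spatial _ \<longleftrightarrow> (\<forall>w :: 'a. \<exists>Y. (\<forall>y\<in>Y. completely_join_irreducible y) \<and> w = \<Squnion>Y)"

definition join_semidistributive :: "'a::lattice itself \<Rightarrow> bool" where
  "join_semidistributive _ \<longleftrightarrow>
     (\<forall>x y z :: 'a. x \<squnion> y = x \<squnion> z \<longrightarrow> x \<squnion> y = x \<squnion> (y \<sqinter> z))"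

definition lower_semimodular :: "'a::lattice itself \<Rightarrow> bool" where
  "lower_semimodular _ \<longleftrightarrow>
     (\<forall>a b c :: 'a. a \<prec> b \<longrightarrow> a \<sqinter> c \<prec> b \<sqinter> c \<or> a \<sqinter> c = b \<sqinter> c)"


definition join_irreducible :: "'a::lattice \<Rightarrow> bool" where
  "join_irreducible w \<longleftrightarrow> (\<forall>x y. w = x \<squnion> y \<longrightarrow> w = x \<or> w = y)"

definition Ji :: "'a::bounded_lattice set" where
  "Ji = {w. w \<noteq> \<bottom> \<and> join_irreducible w}"

definition Ji_below :: "'a::bounded_lattice \<Rightarrow> 'a set" where
  "Ji_below a = {p \<in> Ji. p \<le> a}"

definition extreme_points :: "'a::complete_lattice \<Rightarrow> 'a set" where
  "extreme_points w = {x \<in> Ji_below w. \<Squnion>(Ji_below w - {x}) < w}"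

definition join_decomposition :: "'a::complete_lattice \<Rightarrow> 'a set \<Rightarrow> bool" where
  "join_decomposition w A \<longleftrightarrow> w = \<Squnion>A"

definition irredundant_join_decomposition :: "'a::complete_lattice \<Rightarrow> 'a set \<Rightarrow> bool" where
  "irredundant_join_decomposition w A \<longleftrightarrow>
     join_decomposition w A \<and> (\<forall>a\<in>A. \<Squnion>(A - {a}) < w)"

definition refines :: "'a::order set \<Rightarrow> 'a set \<Rightarrow> bool" where
  "refines A B \<longleftrightarrow> (\<forall>a\<in>A. \<exists>b\<in>B. a \<le> b)"

definition canonical_join_decomposition :: "'a::complete_lattice \<Rightarrow> 'a set \<Rightarrow> bool" where
  "canonical_join_decomposition w A \<longleftrightarrow>
     join_decomposition w A \<and> (\<forall>B. join_decomposition w B \<longrightarrow> refines A B)"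


text \<open>
  The operator \<open>\<gamma>\<close> is a total function in HOL; only its values on subsets of \<open>X\<close> matter.
\<close>

definition closure_system :: "'x set \<Rightarrow> ('x set \<Rightarrow> 'x set) \<Rightarrow> bool" where
  "closure_system X \<gamma> \<longleftrightarrow>
     (\<forall>A. A \<subseteq> X \<longrightarrow> \<gamma> A \<subseteq> X) \<and>
     (\<forall>A. A \<subseteq> X \<longrightarrow> A \<subseteq> \<gamma> A) \<and>
     (\<forall>A B. A \<subseteq> B \<longrightarrow> B \<subseteq> X \<longrightarrow> \<gamma> A \<subseteq> \<gamma> B) \<and>
     (\<forall>A. A \<subseteq> X \<longrightarrow> \<gamma> (\<gamma> A) = \<gamma> A)"

definition Cld :: "'x set \<Rightarrow> ('x set \<Rightarrow> 'x set) \<Rightarrow> 'x set set" where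
  "Cld X \<gamma> = {A. A \<subseteq> X \<and> \<gamma> A = A}"

definition anti_exchange :: "'x set \<Rightarrow> ('x set \<Rightarrow> 'x set) \<Rightarrow> bool" where
  "anti_exchange X \<gamma> \<longleftrightarrow>
     (\<forall>x\<in>X. \<forall>y\<in>X. \<forall>A\<in>Cld X \<gamma>.
        x \<noteq> y \<longrightarrow> x \<in> \<gamma> (A \<union> {y}) \<longrightarrow> x \<notin> A \<longrightarrow> y \<notin> \<gamma> (A \<union> {x}))"

definition singleton_covers :: "'x set \<Rightarrow> ('x set \<Rightarrow> 'x set) \<Rightarrow> bool" where
  "singleton_covers X \<gamma> \<longleftrightarrow> (\<forall>A B. covered_in (Cld X \<gamma>) A B \<longrightarrow> card (B - A) = 1)"

definition isomorphic_to_Cld ::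
    "'a::lattice itself \<Rightarrow> 'x set \<Rightarrow> ('x set \<Rightarrow> 'x set) \<Rightarrow> bool" where
  "isomorphic_to_Cld _ X \<gamma> \<longleftrightarrow>
     (\<exists>f :: 'a \<Rightarrow> 'x set. bij_betw f UNIV (Cld X \<gamma>) \<and> (\<forall>a b. a \<le> b \<longleftrightarrow> f a \<subseteq> f b))"

text \<open>
  The second type argument fixes the type from which the points of the closure system are drawn,
  since HOL has no existential quantification over types.
\<close>

definition anti_exchange_representable ::
    "'a::lattice itself \<Rightarrow> 'x itself \<Rightarrow> bool" where
  "anti_exchange_representable L _ \<longleftrightarrow>
     (\<exists>(X :: 'x set) \<gamma>. closure_system X \<gamma> \<and> anti_exchange X \<gamma> \<and> isomorphic_to_Cld L X \<gamma>)"

definition singleton_cover_representable ::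
    "'a::lattice itself \<Rightarrow> 'x itself \<Rightarrow> bool" where
  "singleton_cover_representable L _ \<longleftrightarrow>
     (\<exists>(X :: 'x set) \<gamma>. closure_system X \<gamma> \<and> singleton_covers X \<gamma> \<and> isomorphic_to_Cld L X \<gamma>)"

end

theory Submission
  imports Defs
begin

text \<open>
  All six conditions say that passing from an element to an upper cover brings in exactly one new
  join irreducible element. The last one says so literally and serves, under the name
  \<open>unique_new_irreducible\<close>, as the hub of the proof. In a spatial lattice there is always at least
  one new join irreducible, so only uniqueness matters.

  Strong coatomicity is used in two ways. It gives every join irreducible \<open>j\<close> a lower cover that
  lies above everything strictly below \<open>j\<close> (\<open>Ji_lower_cover\<close>), and it lets a strict inequality
  \<open>a < w\<close> be sharpened to a covering \<open>c \<prec> w\<close> with \<open>a \<le> c\<close>, to which the hub condition applies.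

  Semidistributivity and lower semimodularity: if \<open>j\<close> and \<open>k\<close> are both new in \<open>c \<prec> w\<close>, then
  \<open>c \<squnion> j = w = c \<squnion> k\<close>, so \<open>j \<sqinter> k\<close> is not below \<open>c\<close> by semidistributivity, whereas lower
  semimodularity puts everything strictly below \<open>j\<close>, and likewise below \<open>k\<close>, under \<open>c\<close>; hence
  \<open>j = j \<sqinter> k = k\<close>. The converse picks new join irreducibles that violate uniqueness.

  Decompositions: an extreme point of \<open>w\<close> is the same thing as a join irreducible that is the only
  new one in some covering \<open>c \<prec> w\<close>. An extreme point must lie below a member of every join
  representation of \<open>w\<close>, which makes \<open>extreme_points w\<close>, as soon as it joins to \<open>w\<close>, canonical and
  the only irredundant decomposition of \<open>w\<close> into join irreducibles. Conversely, if a member \<open>a\<close> of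
  a canonical irredundant decomposition into join irreducibles is not extreme, some
  join irreducible \<open>p > a\<close> can take the place of the members below it, \<open>a\<close> among them, which yields
  a second irredundant decomposition.

  Closure systems: under the hub condition the lattice is represented by the operator
  \<open>A \<mapsto> Ji_below (\<Squnion>A)\<close> on \<open>Ji\<close>. Conversely, in any representation by closed sets, a join irreducible
  is the closure of any point that it has and its lower cover does not have; so if coverings add
  one point, they add at most one join irreducible. Coverings do add one point under anti-exchange,
  because two new points would generate each other.
\<close>

definition unique_new_irreducible :: "'a::complete_lattice itself \<Rightarrow> bool" where
  "unique_new_irreducible _ \<longleftrightarrow>
     (\<forall>w c :: 'a. c \<prec> w \<longrightarrow> (\<exists>!j. j \<in> Ji \<and> j \<le> w \<and> \<not> j \<le> c))"


section \<open>Join irreducible elements of strongly coatomic and of spatial lattices\<close>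

lemma covered_by_less: "a \<prec> b \<Longrightarrow> a < b"
  by (simp add: covered_in_def)

lemma covered_by_between:
  assumes "c \<prec> w" and "c \<le> d" and "d \<le> w"
  shows "d = c \<or> d = w"
  using assms by (auto simp: covered_in_def order.order_iff_strict)

lemma covered_by_sup:
  fixes c w x :: "'a::lattice"
  assumes "c \<prec> w" and "x \<le> w" and "\<not> x \<le> c"
  shows "c \<squnion> x = w"
  using covered_by_between[OF assms(1), of "c \<squnion> x"] covered_by_less[OF assms(1)] assms(2,3)
  by (metis le_supI less_imp_le sup.cobounded1 sup.cobounded2)

lemma strongly_coatomicE:
  assumes "strongly_coatomic TYPE('a::lattice)" and "(a::'a) < w"
  obtains c where "a \<le> c" and "c \<prec> w"
  using assms unfolding strongly_coatomic_def by blast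

text \<open>
  Two distinct lower covers would join to \<open>j\<close>. So the lower cover is unique, and by strong
  coatomicity every element strictly below \<open>j\<close> is below it; that is, \<open>j\<close> is completely join
  irreducible.
\<close>
lemma Ji_lower_cover:
  fixes j :: "'a::complete_lattice"
  assumes sc: "strongly_coatomic TYPE('a)" and j: "j \<in> Ji"
  obtains m where "m \<prec> j" and "\<And>x. x < j \<Longrightarrow> x \<le> m"
proof -
  from j have "\<bottom> < j" by (simp add: Ji_def bot.not_eq_extremum)
  then obtain m where m: "m \<prec> j" by (rule strongly_coatomicE[OF sc])
  have "x \<le> m" if "x < j" for x
  proof (rule ccontr)
    assume "\<not> x \<le> m"
    with m that have "j = m \<squnion> x" by (simp add: covered_by_sup)
    with j have "j = m \<or> j = x" by (auto simp: Ji_def join_irreducible_def)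
    with that covered_by_less[OF m] show False by auto
  qed
  with m show thesis by (rule that)
qed

lemma completely_join_irreducible_in_Ji:
  assumes "completely_join_irreducible w"
  shows "w \<in> Ji"
proof -
  have "w \<noteq> \<bottom>"
  proof
    assume "w = \<bottom>"
    then have "w = \<Squnion>{}" by simp
    with assms have "w \<in> {}" unfolding completely_join_irreducible_def by blast
    then show False by simp
  qed
  moreover have "w = x \<or> w = y" if "w = x \<squnion> y" for x y
  proof -
    from that have "w = \<Squnion>{x, y}" by simp
    with assms have "w \<in> {x, y}" unfolding completely_join_irreducible_def by blast
    then show ?thesis by simp
  qed
  ultimately show ?thesis by (auto simp: Ji_def join_irreducible_def)
qed

lemma Sup_Ji_below:
  fixes w :: "'a::complete_lattice"
  assumes "spatial TYPE('a)"
  shows "\<Squnion>(Ji_below w) = w"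
proof (rule antisym)
  show "\<Squnion>(Ji_below w) \<le> w" by (rule Sup_least) (simp add: Ji_below_def)
  obtain Y where Y: "\<forall>y\<in>Y. completely_join_irreducible y" "w = \<Squnion>Y"
    using assms unfolding spatial_def by blast
  then have "Y \<subseteq> Ji_below w"
    by (auto simp: Ji_below_def completely_join_irreducible_in_Ji Sup_upper)
  with Y(2) show "w \<le> \<Squnion>(Ji_below w)" by (metis Sup_subset_mono)
qed

lemma new_irreducibleE:
  fixes a b :: "'a::complete_lattice"
  assumes "spatial TYPE('a)" and "\<not> a \<le> b"
  obtains j where "j \<in> Ji" and "j \<le> a" and "\<not> j \<le> b"
proof -
  have "\<not> \<Squnion>(Ji_below a) \<le> b" using assms by (simp add: Sup_Ji_below)
  then show thesis using that by (auto simp: Ji_below_def Sup_le_iff)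
qed

lemma unique_new_irreducibleD:
  fixes j k :: "'a::complete_lattice"
  assumes "unique_new_irreducible TYPE('a)" and "c \<prec> w"
    and "j \<in> Ji" "j \<le> w" "\<not> j \<le> c" and "k \<in> Ji" "k \<le> w" "\<not> k \<le> c"
  shows "j = k"
  using assms unfolding unique_new_irreducible_def by blast

lemma unique_new_irreducibleI:
  assumes "spatial TYPE('a::complete_lattice)"
    and "\<And>(w::'a) c j k. \<lbrakk>c \<prec> w; j \<in> Ji; j \<le> w; \<not> j \<le> c; k \<in> Ji; k \<le> w; \<not> k \<le> c\<rbrakk> \<Longrightarrow> j = k"
  shows "unique_new_irreducible TYPE('a)"
  unfolding unique_new_irreducible_def
proof (intro allI impI)
  fix w c :: 'a
  assume cw: "c \<prec> w"
  then have "\<not> w \<le> c" using covered_by_less by (auto simp: not_le less_le_not_le)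
  then obtain j where "j \<in> Ji" "j \<le> w" "\<not> j \<le> c"
    by (rule new_irreducibleE[OF assms(1)])
  with cw assms(2) show "\<exists>!j. j \<in> Ji \<and> j \<le> w \<and> \<not> j \<le> c" by blast
qed


section \<open>Join semidistributivity and lower semimodularity\<close>

text \<open>
  Lower semimodularity moves the covering \<open>c \<prec> w\<close> down to \<open>c \<sqinter> j \<prec> j\<close>, and \<open>j\<close> has only one lower
  cover, above everything strictly below \<open>j\<close>.
\<close>
lemma new_irreducible_below:
  fixes j :: "'a::complete_lattice"
  assumes sc: "strongly_coatomic TYPE('a)" and lsm: "lower_semimodular TYPE('a)"
    and "c \<prec> w" and "j \<in> Ji" "j \<le> w" "\<not> j \<le> c" and "x < j"
  shows "x \<le> c"
proof -
  obtain m where m: "\<And>x. x < j \<Longrightarrow> x \<le> m" "m \<prec> j"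
    using Ji_lower_cover[OF sc \<open>j \<in> Ji\<close>] by blast
  have "w \<sqinter> j = j" and "c \<sqinter> j \<noteq> j" using assms(5,6) by (auto simp: inf_absorb2 le_iff_inf inf.commute)
  then have cover: "c \<sqinter> j \<prec> j"
    using lsm \<open>c \<prec> w\<close> unfolding lower_semimodular_def by metis
  then have "c \<sqinter> j \<le> m" by (intro m(1) covered_by_less)
  then have "m = c \<sqinter> j"
    using covered_by_between[OF cover, of m] covered_by_less[OF m(2)] by (auto simp: less_imp_le)
  with m(1)[OF \<open>x < j\<close>] show ?thesis by simp
qed

lemma unique_new_irreducible_if_semidistributive_semimodular:
  assumes sc: "strongly_coatomic TYPE('a::complete_lattice)" and sp: "spatial TYPE('a)"
    and jsd: "join_semidistributive TYPE('a)" and lsm: "lower_semimodular TYPE('a)"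
  shows "unique_new_irreducible TYPE('a)"
proof (rule unique_new_irreducibleI[OF sp])
  fix w c j k :: 'a
  assume cw: "c \<prec> w" and j: "j \<in> Ji" "j \<le> w" "\<not> j \<le> c" and k: "k \<in> Ji" "k \<le> w" "\<not> k \<le> c"
  have "c \<squnion> j = w" "c \<squnion> k = w" using covered_by_sup cw j k by blast+
  then have "c \<squnion> (j \<sqinter> k) = w" using jsd unfolding join_semidistributive_def by metis
  then have "\<not> j \<sqinter> k \<le> c" using covered_by_less[OF cw] by (auto simp: sup_absorb1)
  then have "\<not> j \<sqinter> k < j" "\<not> j \<sqinter> k < k"
    using new_irreducible_below[OF sc lsm cw] j k by blast+
  then show "j = k" by (metis inf.cobounded1 inf.cobounded2 order.not_eq_order_implies_strict)
qed

lemma lower_semimodular_if_unique_new_irreducible: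
  assumes sp: "spatial TYPE('a::complete_lattice)" and un: "unique_new_irreducible TYPE('a)"
  shows "lower_semimodular TYPE('a)"
  unfolding lower_semimodular_def
proof (intro allI impI)
  fix a b c :: 'a
  assume ab: "a \<prec> b"
  have le: "a \<sqinter> c \<le> b \<sqinter> c" using covered_by_less[OF ab] by (intro inf_mono) auto
  have "\<not> (a \<sqinter> c < d \<and> d < b \<sqinter> c)" for d
  proof
    assume d: "a \<sqinter> c < d \<and> d < b \<sqinter> c"
    \<comment> \<open>One new join irreducible for each half of \<open>a \<sqinter> c < d < b \<sqinter> c\<close>; both are new in \<open>a \<prec> b\<close>.\<close>
    obtain k where k: "k \<in> Ji" "k \<le> d" "\<not> k \<le> a \<sqinter> c"
      using new_irreducibleE[OF sp, of d "a \<sqinter> c"] d by (metis leD)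
    obtain j where j: "j \<in> Ji" "j \<le> b \<sqinter> c" "\<not> j \<le> d"
      using new_irreducibleE[OF sp, of "b \<sqinter> c" d] d by (metis leD)
    have "k \<le> b \<sqinter> c" using k(2) d by (meson less_imp_le order_trans)
    moreover have "\<not> j \<le> a \<sqinter> c" using j(3) d by (meson less_imp_le order_trans)
    ultimately have "j = k"
      using j(1,2) k(1,3) by (intro unique_new_irreducibleD[OF un ab]) auto
    with k j show False by simp
  qed
  with le show "a \<sqinter> c \<prec> b \<sqinter> c \<or> a \<sqinter> c = b \<sqinter> c"
    by (auto simp: covered_in_def order.order_iff_strict)
qed

lemma join_semidistributive_if_unique_new_irreducible:
  assumes sc: "strongly_coatomic TYPE('a::complete_lattice)" and sp: "spatial TYPE('a)"
    and un: "unique_new_irreducible TYPE('a)"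
  shows "join_semidistributive TYPE('a)"
  unfolding join_semidistributive_def
proof (intro allI impI)
  fix x y z :: 'a
  assume eq: "x \<squnion> y = x \<squnion> z"
  have le: "x \<squnion> (y \<sqinter> z) \<le> x \<squnion> y" by (simp add: le_supI2 le_infI1)
  show "x \<squnion> y = x \<squnion> (y \<sqinter> z)"
  proof (rule ccontr)
    assume "x \<squnion> y \<noteq> x \<squnion> (y \<sqinter> z)"
    with le have "x \<squnion> (y \<sqinter> z) < x \<squnion> y" by (metis order.not_eq_order_implies_strict)
    then obtain c where c: "x \<squnion> (y \<sqinter> z) \<le> c" "c \<prec> x \<squnion> y" by (rule strongly_coatomicE[OF sc])
    have "\<not> x \<squnion> y \<le> c" using covered_by_less[OF c(2)] by (metis leD)
    with c(1) eq have "\<not> y \<le> c" "\<not> z \<le> c" by (metis le_supI le_sup_iff)+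
    then obtain j k where j: "j \<in> Ji" "j \<le> y" "\<not> j \<le> c" and k: "k \<in> Ji" "k \<le> z" "\<not> k \<le> c"
      by (meson new_irreducibleE[OF sp])
    have "j = k"
    proof (rule unique_new_irreducibleD[OF un c(2)])
      show "j \<le> x \<squnion> y" using j(2) by (rule le_supI2)
      show "k \<le> x \<squnion> y" unfolding eq using k(2) by (rule le_supI2)
    qed (use j k in auto)
    with j k have "j \<le> y \<sqinter> z" by simp
    with c(1) j(3) show False by (meson le_sup_iff order_trans)
  qed
qed


section \<open>Extreme points and irredundant decompositions\<close>

text \<open>
  An element \<open>b\<close> of a spatial lattice is the join of \<open>Ji_below b\<close>, and \<open>x\<close> is not among these. For
  an extreme point \<open>x\<close> of \<open>w\<close> the bound is strictly below \<open>w\<close>, so a set with join \<open>w\<close> cannot consist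
  of such elements \<open>b\<close> only.
\<close>
lemma le_Sup_without_extreme_point:
  fixes b :: "'a::complete_lattice"
  assumes sp: "spatial TYPE('a)" and "b \<le> w" and "\<not> x \<le> b"
  shows "b \<le> \<Squnion>(Ji_below w - {x})"
proof -
  have "Ji_below b \<subseteq> Ji_below w - {x}" using assms(2,3) by (auto simp: Ji_below_def)
  then have "\<Squnion>(Ji_below b) \<le> \<Squnion>(Ji_below w - {x})" by (rule Sup_subset_mono)
  then show ?thesis by (simp add: Sup_Ji_below[OF sp])
qed

text \<open>
  The new join irreducible of a covering \<open>c \<prec> w\<close> is extreme in \<open>w\<close>, since all the others join to
  at most \<open>c\<close>. If the extreme points did not join to \<open>w\<close>, one could take \<open>c\<close> above all of them,
  the new one included.
\<close>
lemma Sup_extreme_points_if_unique_new_irreducible: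
  fixes w :: "'a::complete_lattice"
  assumes sc: "strongly_coatomic TYPE('a)" and sp: "spatial TYPE('a)"
    and un: "unique_new_irreducible TYPE('a)"
  shows "w = \<Squnion>(extreme_points w)"
proof (rule ccontr)
  assume ne: "w \<noteq> \<Squnion>(extreme_points w)"
  have "\<Squnion>(extreme_points w) \<le> w"
    by (rule Sup_least) (auto simp: extreme_points_def Ji_below_def)
  with ne have "\<Squnion>(extreme_points w) < w" by simp
  then obtain c where c: "\<Squnion>(extreme_points w) \<le> c" "c \<prec> w" by (rule strongly_coatomicE[OF sc])
  note cw = covered_by_less[OF c(2)]
  obtain j where j: "j \<in> Ji" "j \<le> w" "\<not> j \<le> c"
    using new_irreducibleE[OF sp, of w c] cw by (metis leD)
  have "\<Squnion>(Ji_below w - {j}) \<le> c"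
  proof (rule Sup_least)
    fix k assume "k \<in> Ji_below w - {j}"
    then show "k \<le> c"
      using unique_new_irreducibleD[OF un c(2) j] by (auto simp: Ji_below_def)
  qed
  with cw j have "j \<in> extreme_points w" by (auto simp: extreme_points_def Ji_below_def)
  then have "j \<le> c" using c(1) by (meson Sup_upper order_trans)
  with j(3) show False ..
qed

lemma unique_new_irreducible_if_Sup_extreme_points:
  assumes sp: "spatial TYPE('a::complete_lattice)"
    and ex: "\<forall>w :: 'a. w = \<Squnion>(extreme_points w)"
  shows "unique_new_irreducible TYPE('a)"
proof (rule unique_new_irreducibleI[OF sp])
  fix w c j k :: 'a
  assume cw: "c \<prec> w" and j: "j \<in> Ji" "j \<le> w" "\<not> j \<le> c" and k: "k \<in> Ji" "k \<le> w" "\<not> k \<le> c"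
  have "\<not> \<Squnion>(extreme_points w) \<le> c"
    using covered_by_less[OF cw] ex by (metis leD)
  then obtain x where x: "x \<in> extreme_points w" "\<not> x \<le> c" by (auto simp: Sup_le_iff)
  let ?d = "\<Squnion>(Ji_below w - {x})"
  have "?d < w" using x(1) by (simp add: extreme_points_def)
  moreover have "c \<le> ?d"
    using le_Sup_without_extreme_point[OF sp _ x(2)] covered_by_less[OF cw] by simp
  ultimately have "?d = c" using covered_by_between[OF cw, of ?d] by (auto simp: less_imp_le)
  then have "i = x" if "i \<in> Ji" "i \<le> w" "\<not> i \<le> c" for i
    using that Sup_upper[of i "Ji_below w - {x}"] by (auto simp: Ji_below_def)
  with j k show "j = k" by blast
qed

lemma extreme_points_refines:
  fixes w :: "'a::complete_lattice"
  assumes sp: "spatial TYPE('a)" and B: "join_decomposition w B"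
  shows "refines (extreme_points w) B"
  unfolding refines_def
proof (rule ballI, rule ccontr)
  fix x assume x: "x \<in> extreme_points w" and "\<not> (\<exists>b\<in>B. x \<le> b)"
  then have "b \<le> \<Squnion>(Ji_below w - {x})" if "b \<in> B" for b
    using that B by (intro le_Sup_without_extreme_point[OF sp])
      (auto simp: join_decomposition_def Sup_upper)
  then have "w \<le> \<Squnion>(Ji_below w - {x})"
    using B by (auto simp: join_decomposition_def Sup_le_iff)
  with x show False by (auto simp: extreme_points_def)
qed

lemma irredundant_extreme_points:
  assumes "w = \<Squnion>(extreme_points w)"
  shows "irredundant_join_decomposition w (extreme_points w)"
  unfolding irredundant_join_decomposition_def
proof (intro conjI ballI)
  show "join_decomposition w (extreme_points w)" using assms by (simp add: join_decomposition_def)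
  fix x assume "x \<in> extreme_points w"
  then have "\<Squnion>(Ji_below w - {x}) < w" by (simp add: extreme_points_def)
  moreover have "\<Squnion>(extreme_points w - {x}) \<le> \<Squnion>(Ji_below w - {x})"
    by (rule Sup_subset_mono) (auto simp: extreme_points_def)
  ultimately show "\<Squnion>(extreme_points w - {x}) < w" by simp
qed

text \<open>
  No decomposition into join irreducibles can omit an extreme point, and an irredundant one cannot
  contain anything beyond a subset that already joins to \<open>w\<close>.
\<close>
lemma irredundant_eq_extreme_points:
  fixes w :: "'a::complete_lattice"
  assumes ex: "w = \<Squnion>(extreme_points w)"
    and A: "A \<subseteq> Ji" "irredundant_join_decomposition w A"
  shows "A = extreme_points w"
proof -
  have w: "w = \<Squnion>A" and irr: "\<And>a. a \<in> A \<Longrightarrow> \<Squnion>(A - {a}) < w"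
    using A(2) by (auto simp: irredundant_join_decomposition_def join_decomposition_def)
  have below: "A \<subseteq> Ji_below w" using A(1) w by (auto simp: Ji_below_def Sup_upper)
  have sub: "extreme_points w \<subseteq> A"
  proof (rule subsetI, rule ccontr)
    fix x assume x: "x \<in> extreme_points w" "x \<notin> A"
    with below have "A \<subseteq> Ji_below w - {x}" by auto
    then have "w \<le> \<Squnion>(Ji_below w - {x})" using w by (metis Sup_subset_mono)
    with x(1) show False by (auto simp: extreme_points_def)
  qed
  have "a \<in> extreme_points w" if "a \<in> A" for a
  proof (rule ccontr)
    assume "a \<notin> extreme_points w"
    with sub have "extreme_points w \<subseteq> A - {a}" by auto
    then have "w \<le> \<Squnion>(A - {a})" using ex by (metis Sup_subset_mono)
    with irr[OF that] show False by simp
  qed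
  with sub show ?thesis by auto
qed

lemma irredundant_antichain:
  assumes A: "irredundant_join_decomposition w A" and "a \<in> A" "b \<in> A" and "a \<le> b"
  shows "a = b"
proof (rule ccontr)
  assume "a \<noteq> b"
  have w: "w = \<Squnion>A" and irr: "\<Squnion>(A - {a}) < w"
    using A \<open>a \<in> A\<close> by (auto simp: irredundant_join_decomposition_def join_decomposition_def)
  have "b \<le> \<Squnion>(A - {a})" using \<open>a \<noteq> b\<close> \<open>b \<in> A\<close> by (intro Sup_upper) auto
  then have "x \<le> \<Squnion>(A - {a})" if "x \<in> A" for x
    using that \<open>a \<le> b\<close> by (cases "x = a") (auto intro: Sup_upper)
  then have "w \<le> \<Squnion>(A - {a})" using w by (auto simp: Sup_le_iff)
  with irr show False by simp
qed

text \<open>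
  If \<open>a \<in> A\<close> is not extreme, then \<open>Ji_below w - {a}\<close> is a join representation of \<open>w\<close>, and canonicity
  gives \<open>p > a\<close> in it. Putting \<open>p\<close> in the place of all members of \<open>A\<close> below \<open>p\<close> gives
  another irredundant decomposition: if some \<open>b \<noteq> p\<close> were redundant in it, then by canonicity
  \<open>b\<close> would lie below \<open>p\<close> or below another member of \<open>A\<close>; and without \<open>p\<close> it is contained in
  \<open>A - {a}\<close>.
\<close>
lemma canonical_subset_extreme_points:
  fixes w :: "'a::complete_lattice"
  assumes sp: "spatial TYPE('a)"
    and A: "A \<subseteq> Ji" "irredundant_join_decomposition w A"
    and can: "canonical_join_decomposition w A"
    and uniq: "\<And>B. \<lbrakk>B \<subseteq> Ji; irredundant_join_decomposition w B\<rbrakk> \<Longrightarrow> B = A"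
  shows "A \<subseteq> extreme_points w"
proof (rule subsetI, rule ccontr)
  fix a assume a: "a \<in> A" and not_ex: "a \<notin> extreme_points w"
  have w: "w = \<Squnion>A" and irr: "\<And>a. a \<in> A \<Longrightarrow> \<Squnion>(A - {a}) < w"
    using A(2) by (auto simp: irredundant_join_decomposition_def join_decomposition_def)
  have refines: "\<exists>b\<in>B. a \<le> b" if "w = \<Squnion>B" "a \<in> A" for a B
    using can that by (auto simp: canonical_join_decomposition_def join_decomposition_def refines_def)
  have le_w: "\<Squnion>B \<le> w" if "B \<subseteq> Ji_below w" for B
    using that by (auto simp: Ji_below_def intro: Sup_least)
  have below: "A \<subseteq> Ji_below w" using A(1) w by (auto simp: Ji_below_def Sup_upper)
  with a not_ex have "\<not> \<Squnion>(Ji_below w - {a}) < w" by (auto simp: extreme_points_def)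
  with le_w have "w = \<Squnion>(Ji_below w - {a})"
    by (metis Diff_subset order.not_eq_order_implies_strict)
  then obtain p where p: "p \<in> Ji_below w" "p \<noteq> a" "a \<le> p" using refines a by blast
  define B where "B = insert p {b \<in> A. \<not> b \<le> p}"
  have B_below: "B \<subseteq> Ji_below w" using below p(1) by (auto simp: B_def)
  have "x \<le> \<Squnion>B" if "x \<in> A" for x
  proof (cases "x \<le> p")
    case True
    have "p \<le> \<Squnion>B" by (rule Sup_upper) (simp add: B_def)
    with True show ?thesis by (rule order_trans)
  next
    case False
    with that show ?thesis by (intro Sup_upper) (simp add: B_def)
  qed
  then have "w \<le> \<Squnion>B" using w by (auto simp: Sup_le_iff)
  with le_w[OF B_below] have wB: "w = \<Squnion>B" by (simp only: order.eq_iff)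
  have "\<Squnion>(B - {b}) < w" if "b \<in> B" for b
  proof (cases "b = p")
    case True
    have "B - {p} \<subseteq> A - {a}" using p(3) by (auto simp: B_def)
    then have "\<Squnion>(B - {p}) \<le> \<Squnion>(A - {a})" by (rule Sup_subset_mono)
    with irr[OF a] True show ?thesis by simp
  next
    case False
    with that have b: "b \<in> A" "\<not> b \<le> p" by (auto simp: B_def)
    have "w \<noteq> \<Squnion>(B - {b})"
    proof
      assume "w = \<Squnion>(B - {b})"
      then obtain x where "x \<in> B - {b}" "b \<le> x" using refines b(1) by blast
      with b show False using irredundant_antichain[OF A(2)] by (auto simp: B_def)
    qed
    moreover have "\<Squnion>(B - {b}) \<le> w" using B_below by (intro le_w) auto
    ultimately show ?thesis by simp
  qed
  with wB have "irredundant_join_decomposition w B"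
    by (auto simp: irredundant_join_decomposition_def join_decomposition_def)
  moreover have "B \<subseteq> Ji" using B_below by (auto simp: Ji_below_def)
  ultimately have "B = A" by (intro uniq)
  then have "p \<in> A" by (auto simp: B_def)
  with irredundant_antichain[OF A(2) a _ p(3)] p(2) show False by blast
qed

lemma Sup_extreme_points_iff_canonical:
  fixes w :: "'a::complete_lattice"
  assumes sp: "spatial TYPE('a)"
  shows "w = \<Squnion>(extreme_points w) \<longleftrightarrow>
    (\<exists>!A. A \<subseteq> Ji \<and> irredundant_join_decomposition w A) \<and>
    (\<forall>A. A \<subseteq> Ji \<and> irredundant_join_decomposition w A \<longrightarrow> canonical_join_decomposition w A)"
    (is "_ \<longleftrightarrow> ?R")
proof
  assume ex: "w = \<Squnion>(extreme_points w)"
  have "extreme_points w \<subseteq> Ji" by (auto simp: extreme_points_def Ji_below_def)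
  moreover note irredundant_extreme_points[OF ex]
  moreover have "canonical_join_decomposition w (extreme_points w)"
    using ex extreme_points_refines[OF sp]
    by (auto simp: canonical_join_decomposition_def join_decomposition_def)
  ultimately show ?R using irredundant_eq_extreme_points[OF ex] by metis
next
  assume R: ?R
  then obtain A where A: "A \<subseteq> Ji" "irredundant_join_decomposition w A" by blast
  with R have "A \<subseteq> extreme_points w"
    by (intro canonical_subset_extreme_points[OF sp]) blast+
  then have "\<Squnion>A \<le> \<Squnion>(extreme_points w)" by (rule Sup_subset_mono)
  moreover have "w = \<Squnion>A"
    using A(2) by (simp add: irredundant_join_decomposition_def join_decomposition_def)
  moreover have "\<Squnion>(extreme_points w) \<le> w"
    by (rule Sup_least) (auto simp: extreme_points_def Ji_below_def)
  ultimately show "w = \<Squnion>(extreme_points w)" by (metis antisym)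
qed


section \<open>Representation by closure systems\<close>

lemma closure_system_least:
  assumes "closure_system X \<gamma>" and "A \<subseteq> B" and "B \<in> Cld X \<gamma>"
  shows "\<gamma> A \<subseteq> B"
  using assms unfolding closure_system_def Cld_def by (metis (mono_tags, lifting) mem_Collect_eq)

lemma closure_system_closure_in_Cld:
  assumes "closure_system X \<gamma>" and "A \<subseteq> X"
  shows "\<gamma> A \<in> Cld X \<gamma>" and "A \<subseteq> \<gamma> A"
  using assms by (auto simp: closure_system_def Cld_def)

text \<open>
  If \<open>A \<prec> B\<close>, adding any one point of \<open>B - A\<close> to \<open>A\<close> generates \<open>B\<close>, so two such points would
  generate each other over \<open>A\<close>.
\<close>
lemma singleton_covers_if_anti_exchange:
  assumes cs: "closure_system X \<gamma>" and ae: "anti_exchange X \<gamma>"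
  shows "singleton_covers X \<gamma>"
  unfolding singleton_covers_def
proof (intro allI impI)
  fix A B assume cov: "covered_in (Cld X \<gamma>) A B"
  then have A: "A \<in> Cld X \<gamma>" and B: "B \<in> Cld X \<gamma>" and AB: "A \<subset> B"
    by (auto simp: covered_in_def)
  have BX: "B \<subseteq> X" using B by (simp add: Cld_def)
  have gen: "\<gamma> (A \<union> {x}) = B" if x: "x \<in> B - A" for x
  proof -
    have sub: "A \<union> {x} \<subseteq> B" using x AB by auto
    then have cl: "\<gamma> (A \<union> {x}) \<in> Cld X \<gamma>" and ext: "A \<union> {x} \<subseteq> \<gamma> (A \<union> {x})"
      using closure_system_closure_in_Cld[OF cs] BX by (meson subset_trans)+
    then have "A \<subset> \<gamma> (A \<union> {x})" using x by auto
    moreover have "\<gamma> (A \<union> {x}) \<subseteq> B" by (rule closure_system_least[OF cs sub B])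
    ultimately show ?thesis using cov cl by (auto simp: covered_in_def)
  qed
  from AB obtain x where x: "x \<in> B - A" by auto
  have "y = x" if y: "y \<in> B - A" for y
  proof (rule ccontr)
    assume "y \<noteq> x"
    moreover have "x \<in> \<gamma> (A \<union> {y})" "y \<in> \<gamma> (A \<union> {x})" using gen x y by auto
    ultimately show False using ae A x y BX unfolding anti_exchange_def by blast
  qed
  with x have "B - A = {x}" by blast
  then show "card (B - A) = 1" by simp
qed

lemma covered_in_image:
  fixes f :: "'a::lattice \<Rightarrow> 'x set"
  assumes "bij_betw f UNIV S" and "\<And>a b. a \<le> b \<longleftrightarrow> f a \<subseteq> f b"
  shows "covered_in S (f a) (f b) \<longleftrightarrow> a \<prec> b"
proof -
  have S: "S = range f" using assms(1) by (simp add: bij_betw_def)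
  have less: "f a \<subset> f b \<longleftrightarrow> a < b" for a b
    using assms(2) by (simp add: less_le_not_le)
  show ?thesis unfolding covered_in_def S by (simp add: less)
qed

text \<open>
  Let \<open>f\<close> be the isomorphism and \<open>y\<close> a point that \<open>f j\<close> has and \<open>f m\<close>, for the lower cover \<open>m\<close> of
  \<open>j\<close>, has not. Any \<open>a \<le> j\<close> whose closed set contains \<open>y\<close> cannot be below \<open>m\<close>, so it is \<open>j\<close>; hence
  \<open>f j\<close> is the closure of \<open>y\<close>.
\<close>
lemma Ji_generating_point:
  fixes f :: "'a::complete_lattice \<Rightarrow> 'x set"
  assumes sc: "strongly_coatomic TYPE('a)" and cs: "closure_system X \<gamma>"
    and bij: "bij_betw f UNIV (Cld X \<gamma>)" and le: "\<And>a b. a \<le> b \<longleftrightarrow> f a \<subseteq> f b"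
    and j: "j \<in> Ji"
  obtains y where "y \<in> X" and "f j = \<gamma> {y}"
proof -
  have cld: "f a \<in> Cld X \<gamma>" for a using bij by (auto simp: bij_betw_def)
  obtain m where m: "m \<prec> j" "\<And>x. x < j \<Longrightarrow> x \<le> m" by (rule Ji_lower_cover[OF sc j]) blast
  have "\<not> f j \<subseteq> f m" using covered_by_less[OF m(1)] le by (metis leD)
  then obtain y where y: "y \<in> f j" "y \<notin> f m" by auto
  then have yX: "y \<in> X" using cld[of j] by (auto simp: Cld_def)
  then have cl: "\<gamma> {y} \<in> Cld X \<gamma>" and y_in: "y \<in> \<gamma> {y}"
    using closure_system_closure_in_Cld[OF cs, of "{y}"] by auto
  then obtain g where g: "f g = \<gamma> {y}" using bij by (metis bij_betw_def imageE)
  have "f g \<subseteq> f j" unfolding g using y(1) cld by (intro closure_system_least[OF cs]) auto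
  then have "g \<le> j" by (simp add: le)
  moreover have "\<not> g \<le> m" using y(2) y_in by (auto simp: le g)
  ultimately have "g = j" using m(2) by (auto simp: order.order_iff_strict)
  with g yX show thesis by (intro that) auto
qed

lemma unique_new_irreducible_if_singleton_cover_representable:
  assumes sc: "strongly_coatomic TYPE('a::complete_lattice)" and sp: "spatial TYPE('a)"
    and rep: "singleton_cover_representable TYPE('a) TYPE('x)"
  shows "unique_new_irreducible TYPE('a)"
proof -
  obtain X :: "'x set" and \<gamma> and f :: "'a \<Rightarrow> 'x set"
    where cs: "closure_system X \<gamma>" and one: "singleton_covers X \<gamma>"
      and bij: "bij_betw f UNIV (Cld X \<gamma>)" and le: "\<And>a b. a \<le> b \<longleftrightarrow> f a \<subseteq> f b"
    using rep unfolding singleton_cover_representable_def isomorphic_to_Cld_def by blast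
  have cld: "f a \<in> Cld X \<gamma>" for a using bij by (auto simp: bij_betw_def)
  show ?thesis
  proof (rule unique_new_irreducibleI[OF sp])
    fix w c j k :: 'a
    assume cw: "c \<prec> w" and j: "j \<in> Ji" "j \<le> w" "\<not> j \<le> c" and k: "k \<in> Ji" "k \<le> w" "\<not> k \<le> c"
    have "covered_in (Cld X \<gamma>) (f c) (f w)" using cw by (simp add: covered_in_image[OF bij le])
    then have "card (f w - f c) = 1" using one by (simp add: singleton_covers_def)
    then obtain x where x: "f w - f c = {x}" by (rule card_1_singletonE)
    \<comment> \<open>A generating point of a new join irreducible is outside \<open>f c\<close>, so it is \<open>x\<close>.\<close>
    have "f i = \<gamma> {x}" if i: "i \<in> Ji" "i \<le> w" "\<not> i \<le> c" for i
    proof -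
      obtain y where y: "y \<in> X" "f i = \<gamma> {y}" by (rule Ji_generating_point[OF sc cs bij le i(1)])
      have "y \<in> f i" using closure_system_closure_in_Cld(2)[OF cs, of "{y}"] y by auto
      then have "y \<in> f w" using i(2) le by auto
      moreover have "y \<notin> f c"
      proof
        assume "y \<in> f c"
        then have "f i \<subseteq> f c" unfolding y(2) using cld by (intro closure_system_least[OF cs]) auto
        with i(3) le show False by simp
      qed
      ultimately have "y = x" using x by blast
      with y show ?thesis by simp
    qed
    with j k have "f j = f k" by simp
    with bij show "j = k" by (simp add: bij_betw_def inj_eq)
  qed
qed

lemma closure_system_Ji_below_Sup:
  "closure_system Ji (\<lambda>A :: 'a::complete_lattice set. Ji_below (\<Squnion>A))"
  unfolding closure_system_def
proof (intro conjI allI impI)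
  fix A B :: "'a set"
  show "Ji_below (\<Squnion>A) \<subseteq> Ji" by (auto simp: Ji_below_def)
  show "A \<subseteq> Ji_below (\<Squnion>A)" if "A \<subseteq> Ji" using that by (auto simp: Ji_below_def Sup_upper)
  show "Ji_below (\<Squnion>A) \<subseteq> Ji_below (\<Squnion>B)" if "A \<subseteq> B"
    using Sup_subset_mono[OF that] by (auto simp: Ji_below_def)
  show "Ji_below (\<Squnion>(Ji_below (\<Squnion>A))) = Ji_below (\<Squnion>A)" if "A \<subseteq> Ji"
  proof -
    have "\<Squnion>(Ji_below (\<Squnion>A)) = \<Squnion>A"
    proof (rule antisym)
      show "\<Squnion>(Ji_below (\<Squnion>A)) \<le> \<Squnion>A" by (rule Sup_least) (simp add: Ji_below_def)
      show "\<Squnion>A \<le> \<Squnion>(Ji_below (\<Squnion>A))"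
        using that by (intro Sup_subset_mono) (auto simp: Ji_below_def Sup_upper)
    qed
    then show ?thesis by simp
  qed
qed

lemma isomorphic_to_Cld_Ji:
  assumes sp: "spatial TYPE('a::complete_lattice)"
  shows "isomorphic_to_Cld TYPE('a) Ji (\<lambda>A :: 'a set. Ji_below (\<Squnion>A))"
  unfolding isomorphic_to_Cld_def
proof (intro exI[of _ Ji_below] conjI)
  have le: "a \<le> b \<longleftrightarrow> Ji_below a \<subseteq> Ji_below b" for a b :: 'a
  proof
    assume "Ji_below a \<subseteq> Ji_below b"
    then have "\<Squnion>(Ji_below a) \<le> \<Squnion>(Ji_below b)" by (rule Sup_subset_mono)
    then show "a \<le> b" by (simp add: Sup_Ji_below[OF sp])
  qed (auto simp: Ji_below_def)
  then show "\<forall>a b :: 'a. a \<le> b \<longleftrightarrow> Ji_below a \<subseteq> Ji_below b" by blast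
  have "inj (Ji_below :: 'a \<Rightarrow> 'a set)" by (rule injI) (metis Sup_Ji_below[OF sp])
  moreover have "range Ji_below = Cld Ji (\<lambda>A :: 'a set. Ji_below (\<Squnion>A))"
  proof
    show "range Ji_below \<subseteq> Cld Ji (\<lambda>A :: 'a set. Ji_below (\<Squnion>A))"
      by (auto simp: Cld_def Sup_Ji_below[OF sp]) (simp add: Ji_below_def)
    show "Cld Ji (\<lambda>A :: 'a set. Ji_below (\<Squnion>A)) \<subseteq> range Ji_below"
    proof
      fix A :: "'a set"
      assume "A \<in> Cld Ji (\<lambda>A. Ji_below (\<Squnion>A))"
      then have "A = Ji_below (\<Squnion>A)" by (simp add: Cld_def)
      then show "A \<in> range Ji_below" by (rule range_eqI)
    qed
  qed
  ultimately show "bij_betw Ji_below UNIV (Cld Ji (\<lambda>A :: 'a set. Ji_below (\<Squnion>A)))"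
    by (simp add: bij_betw_def)
qed

text \<open>
  If \<open>x\<close> and \<open>y\<close> generate each other over \<open>A\<close>, then \<open>\<Squnion>A \<squnion> x = \<Squnion>A \<squnion> y\<close>. Both \<open>x\<close> and \<open>y\<close> are new in
  the covering of a lower cover of this element above \<open>\<Squnion>A\<close>, so they coincide.
\<close>
lemma anti_exchange_Ji:
  assumes sc: "strongly_coatomic TYPE('a::complete_lattice)"
    and un: "unique_new_irreducible TYPE('a)"
  shows "anti_exchange Ji (\<lambda>A :: 'a set. Ji_below (\<Squnion>A))"
  unfolding anti_exchange_def
proof (intro ballI impI notI)
  fix x y :: 'a and A :: "'a set"
  assume x: "x \<in> Ji" and y: "y \<in> Ji" and A: "A \<in> Cld Ji (\<lambda>A. Ji_below (\<Squnion>A))"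
    and "x \<noteq> y" and xy: "x \<in> Ji_below (\<Squnion>(A \<union> {y}))" and "x \<notin> A"
    and yx: "y \<in> Ji_below (\<Squnion>(A \<union> {x}))"
  have "A = Ji_below (\<Squnion>A)" using A by (simp add: Cld_def)
  with x \<open>x \<notin> A\<close> have x_new: "\<not> x \<le> \<Squnion>A" by (auto simp: Ji_below_def)
  have xy': "x \<le> \<Squnion>A \<squnion> y" and yx': "y \<le> \<Squnion>A \<squnion> x"
    using xy yx by (auto simp: Ji_below_def Sup_union_distrib sup.commute)
  have "\<Squnion>A < \<Squnion>A \<squnion> x" using x_new by (simp add: less_le_not_le)
  then obtain c where c: "\<Squnion>A \<le> c" "c \<prec> \<Squnion>A \<squnion> x" by (rule strongly_coatomicE[OF sc])
  have "\<not> \<Squnion>A \<squnion> x \<le> c" using covered_by_less[OF c(2)] by (metis leD)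
  with c(1) have "\<not> x \<le> c" by (meson le_supI)
  moreover have "\<not> y \<le> c"
    using c(1) xy' \<open>\<not> x \<le> c\<close> by (meson le_supI order_trans)
  ultimately have "x = y"
    using x y yx' by (intro unique_new_irreducibleD[OF un c(2)]) auto
  with \<open>x \<noteq> y\<close> show False ..
qed

lemma anti_exchange_representable_if_unique_new_irreducible:
  assumes "strongly_coatomic TYPE('a::complete_lattice)" and "spatial TYPE('a)"
    and "unique_new_irreducible TYPE('a)"
  shows "anti_exchange_representable TYPE('a) TYPE('a)"
  unfolding anti_exchange_representable_def
  using closure_system_Ji_below_Sup anti_exchange_Ji[OF assms(1,3)] isomorphic_to_Cld_Ji[OF assms(2)]
  by blast

lemma singleton_cover_representable_if_anti_exchange_representable:
  assumes "anti_exchange_representable TYPE('a::lattice) TYPE('x)"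
  shows "singleton_cover_representable TYPE('a) TYPE('x)"
  using assms singleton_covers_if_anti_exchange
  unfolding anti_exchange_representable_def singleton_cover_representable_def by blast


section \<open>The equivalence\<close>

(* The equivalences are stated for closure systems whose points have the type 'a of the lattice
   elements; the last two conjuncts, for an arbitrary type 'x, say that allowing points of any
   other type represents no further lattices. *)
theorem theorem10:
  assumes "strongly_coatomic TYPE('a::complete_lattice)"
    and "spatial TYPE('a)"
  shows
    "(let
        P1 = anti_exchange_representable TYPE('a) TYPE('a);
        P2 = singleton_cover_representable TYPE('a) TYPE('a);
        P3 = (join_semidistributive TYPE('a) \<and> lower_semimodular TYPE('a));
        P4 = (\<forall>w :: 'a. w = \<Squnion>(extreme_points w));
        P5 = (\<forall>w :: 'a.
                (\<exists>!A. A \<subseteq> Ji \<and> irredundant_join_decomposition w A) \<and>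
                (\<forall>A. A \<subseteq> Ji \<and> irredundant_join_decomposition w A \<longrightarrow>
                       canonical_join_decomposition w A));
        P6 = (\<forall>w c :: 'a. c \<prec> w \<longrightarrow> (\<exists>!j. j \<in> Ji \<and> j \<le> w \<and> \<not> j \<le> c))
      in (P1 \<longleftrightarrow> P2) \<and> (P2 \<longleftrightarrow> P3) \<and> (P3 \<longleftrightarrow> P4) \<and> (P4 \<longleftrightarrow> P5) \<and> (P5 \<longleftrightarrow> P6)) \<and>
     (anti_exchange_representable TYPE('a) TYPE('x) \<longrightarrow>
        anti_exchange_representable TYPE('a) TYPE('a)) \<and>
     (singleton_cover_representable TYPE('a) TYPE('x) \<longrightarrow>
        singleton_cover_representable TYPE('a) TYPE('a))"
proof -
  note sc = assms(1) and sp = assms(2)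
  let ?U = "unique_new_irreducible TYPE('a)"
  have "singleton_cover_representable TYPE('a) TYPE('a) \<longleftrightarrow> ?U"
    and "anti_exchange_representable TYPE('a) TYPE('a) \<longleftrightarrow> ?U"
    and "singleton_cover_representable TYPE('a) TYPE('x) \<longrightarrow> ?U"
    and "anti_exchange_representable TYPE('a) TYPE('x) \<longrightarrow> ?U"
    using unique_new_irreducible_if_singleton_cover_representable[OF sc sp]
      anti_exchange_representable_if_unique_new_irreducible[OF sc sp]
      singleton_cover_representable_if_anti_exchange_representable by blast+
  moreover have "join_semidistributive TYPE('a) \<and> lower_semimodular TYPE('a) \<longleftrightarrow> ?U"
    using unique_new_irreducible_if_semidistributive_semimodular[OF sc sp]
      lower_semimodular_if_unique_new_irreducible[OF sp]
      join_semidistributive_if_unique_new_irreducible[OF sc sp] by blast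
  moreover have "(\<forall>w :: 'a. w = \<Squnion>(extreme_points w)) \<longleftrightarrow> ?U"
    using unique_new_irreducible_if_Sup_extreme_points[OF sp]
      Sup_extreme_points_if_unique_new_irreducible[OF sc sp] by blast
  ultimately show ?thesis
    unfolding Let_def Sup_extreme_points_iff_canonical[OF sp, symmetric]
      unique_new_irreducible_def[of "TYPE('a)", symmetric]
    by simp
qed

end
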